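(* Let $p\in(0,1)$ and let $(f_n)_{n\ge1}$ be any sequence of functions $f_n:\{0,1\}^n\to[0,1]$. Then $(f_n)_{n\ge1}$ is noise sensitive at intensity $p$ if and only if $$ \lim_{n\to\infty}\mathrm{Var}_r\big(\mathbb{E}_{p/r}\big[f_n(\psi\cdot\xi)\,\big|\,\psi\big]\big)=0\quad\text{for every } r\in(p,1). $$
   Context: For $q\in[0,1]$, $\mathbb{P}_q$ is the product measure on $\{0,1\}^n$ giving each coordinate the value $1$ with probability $q$ and $0$ with probability $1-q$; $\mathbb{E}_q$ and $\mathrm{Var}_q$ are the corresponding expectation and variance. The configurations $\psi,\xi\in\{0,1\}^n$ are independent, with $\psi\sim\mathbb{P}_r$ and $\xi\sim\mathbb{P}_{p/r}$, and $\psi\cdot\xi$ is the coordinate-wise product; $\mathbb{E}_{p/r}[f_n(\psi\cdot\xi)\,|\,\psi]$ is the function of $\psi$ obtained by averaging over $\xi\sim\mathbb{P}_{p/r}$ with $\psi$ fixed, and $\mathrm{Var}_r$ of it is taken over $\psi\sim\mathbb{P}_r$. Noise sensitivity: for $\varepsilon\in(0,1)$ let $\omega\in\{0,1\}^n$ be chosen according to $\mathbb{P}_p$, and let $\omega^\varepsilon$ be obtained from $\omega$ by re-sampling each coordinate independently with probability $\varepsilon$, again according to $\mathbb{P}_p$ (i.e. each re-sampled coordinate gets a fresh independent value that is $1$ with probability $p$). The sequence $(f_n)_{n\ge1}$ is noise sensitive at intensity $p$ if for every $\varepsilon\in(0,1)$ $$\mathbb{E}_p[f_n(\omega)f_n(\omega^\varepsilon)]-\mathbb{E}_p[f_n(\omega)]^2\to0\quad\text{as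 }n\to\infty.$$ *)

theory Defs
  imports "HOL-Probability.Probability"
begin

text \<open>
  A configuration in $\{0,1\}^n$ is a function \<open>nat \<Rightarrow> bool\<close> (\<open>True\<close> for 1, \<open>False\<close> for 0) whose
  coordinates are indexed by \<open>{..<n}\<close> and which is \<open>False\<close> outside, matching the default value
  of \<open>Pi_pmf\<close> below.
\<close>

definition cube :: "nat \<Rightarrow> (nat \<Rightarrow> bool) set" where
  "cube n = PiE_dflt {..<n} False (\<lambda>_. UNIV)"

definition cube_pmf :: "nat \<Rightarrow> real \<Rightarrow> (nat \<Rightarrow> bool) pmf" where
  "cube_pmf n q = Pi_pmf {..<n} False (\<lambda>_. bernoulli_pmf q)"

definition cw_prod :: "(nat \<Rightarrow> bool) \<Rightarrow> (nat \<Rightarrow> bool) \<Rightarrow> (nat \<Rightarrow> bool)" where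
  "cw_prod \<psi> \<xi> = (\<lambda>i. \<psi> i \<and> \<xi> i)"

text \<open>
  The joint law of $(\omega, \omega^\varepsilon)$: independently of \<open>\<omega>\<close>, \<open>\<eta>\<close> marks the
  coordinates to be re-sampled and \<open>\<omega>'\<close> supplies the fresh values.
\<close>

definition noise_pair_pmf :: "nat \<Rightarrow> real \<Rightarrow> real \<Rightarrow> ((nat \<Rightarrow> bool) \<times> (nat \<Rightarrow> bool)) pmf" where
  "noise_pair_pmf n p \<epsilon> =
     do {
       \<omega> \<leftarrow> cube_pmf n p;
       \<eta> \<leftarrow> cube_pmf n \<epsilon>;
       \<omega>' \<leftarrow> cube_pmf n p;
       return_pmf (\<omega>, \<lambda>i. if \<eta> i then \<omega>' i else \<omega> i)
     }"

definition noise_sensitive :: "real \<Rightarrow> (nat \<Rightarrow> (nat \<Rightarrow> bool) \<Rightarrow> real) \<Rightarrow> bool" where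
  "noise_sensitive p f \<longleftrightarrow>
     (\<forall>\<epsilon>\<in>{0<..<1}.
        (\<lambda>n. measure_pmf.expectation (noise_pair_pmf n p \<epsilon>) (\<lambda>(\<omega>, \<omega>\<epsilon>). f n \<omega> * f n \<omega>\<epsilon>)
             - (measure_pmf.expectation (cube_pmf n p) (f n))\<^sup>2) \<longlonglongrightarrow> 0)"

end

theory Submission
  imports Defs
begin

text \<open>
  If \<open>\<xi>, \<xi>'\<close> are independent, \<open>Var\<^sub>r(E[f(\<psi>\<xi>) | \<psi>]) = E[f(\<psi>\<xi>) f(\<psi>\<xi>')] - E[f(\<psi>\<xi>)]\<^sup>2\<close>. In each
  coordinate both \<open>(\<psi>\<xi>, \<psi>\<xi>')\<close> and \<open>(\<omega>, \<omega>\<^sup>\<epsilon>)\<close> have marginals Bernoulli(\<open>p\<close>), and the value (1,1) has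
  probability \<open>p\<^sup>2 / r\<close> and \<open>p (1 - \<epsilon> (1 - p))\<close> respectively. So the two pairs have the same law when
  \<open>p / r = 1 - \<epsilon> (1 - p)\<close>, a bijection between \<open>r \<in> (p, 1)\<close> and \<open>\<epsilon> \<in> (0, 1)\<close>, and the variance
  equals the noise covariance for every \<open>n\<close>.
\<close>

definition thinned_pair_pmf :: "nat \<Rightarrow> real \<Rightarrow> real \<Rightarrow> ((nat \<Rightarrow> bool) \<times> (nat \<Rightarrow> bool)) pmf" where
  "thinned_pair_pmf n r s =
     do {
       \<psi> \<leftarrow> cube_pmf n r;
       \<xi> \<leftarrow> cube_pmf n s;
       \<xi>' \<leftarrow> cube_pmf n s;
       return_pmf (cw_prod \<psi> \<xi>, cw_prod \<psi> \<xi>')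
     }"

text \<open>Lifts a one-coordinate experiment to independent experiments on all of \<open>A\<close>.
  On \<open>A\<close> this is \<open>Pi_pmf_bind\<close> used three times; off \<open>A\<close> the
  sampled functions take the values \<open>d1\<close>, \<open>d2\<close>, \<open>d3\<close>, so the
  condition on \<open>g\<close> makes the defaults match.\<close>

lemma Pi_pmf_bind3:
  assumes "finite A"
    and "g d1 d2 d3 = d"
  shows "Pi_pmf A d (\<lambda>_. do { a \<leftarrow> P; b \<leftarrow> Q; c \<leftarrow> R; return_pmf (g a b c) }) =
         do {
           u \<leftarrow> Pi_pmf A d1 (\<lambda>_. P);
           v \<leftarrow> Pi_pmf A d2 (\<lambda>_. Q);
           w \<leftarrow> Pi_pmf A d3 (\<lambda>_. R);
           return_pmf (\<lambda>x. g (u x) (v x) (w x))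
         }"
proof -
  have dflt: "u x = d'" if "u \<in> set_pmf (Pi_pmf A d' (\<lambda>_. S))" "x \<notin> A"
    for u x and d' :: 'z and S
    using that set_Pi_pmf_subset'[OF assms(1)] by (fastforce simp: PiE_dflt_def)
  show ?thesis
    by (simp add: Pi_pmf_bind[OF assms(1), where d = d and d' = d1]
      Pi_pmf_bind[OF assms(1), where d = d and d' = d2]
      Pi_pmf_bind[OF assms(1), where d = d and d' = d3]
      Pi_pmf_return_pmf[OF assms(1)])
      (auto intro!: bind_pmf_cong ext simp: dflt assms(2))
qed

lemma noise_coordinate_eq_thinned_coordinate:
  assumes "0 < p" "p < r" "r < 1" "0 \<le> \<epsilon>" "\<epsilon> \<le> 1" "p / r = 1 - \<epsilon> * (1 - p)"
  shows "do { a \<leftarrow> bernoulli_pmf p; b \<leftarrow> bernoulli_pmf \<epsilon>; c \<leftarrow> bernoulli_pmf p;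
              return_pmf (a, if b then c else a) } =
         do { a \<leftarrow> bernoulli_pmf r; b \<leftarrow> bernoulli_pmf (p / r); c \<leftarrow> bernoulli_pmf (p / r);
              return_pmf (a \<and> b, a \<and> c) }" (is "?L = ?R")
proof (rule pmf_eqI)
  fix x :: "bool \<times> bool"
  define s where "s = p / r"
  have p: "p = r * s" and s: "0 \<le> s" "s \<le> 1"
    using assms(1-3) by (auto simp: s_def)
  \<comment> \<open>These are the two masses at \<open>(True, True)\<close>. Together with the
    common marginal \<open>p = r * s\<close> they determine the other three atoms.\<close>
  have e: "r * s * s = p * (1 - \<epsilon> * (1 - p))" using p assms(6) by (simp add: s_def)
  obtain a b where x: "x = (a, b)" by (cases x)
  show "pmf ?L x = pmf ?R x"
    unfolding x s_def[symmetric] using assms(1-5) s e p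
    by (cases a; cases b) (simp_all add: pmf_bind algebra_simps)
qed

text \<open>A pair of configurations is treated as one configuration with values in
  \<open>bool \<times> bool\<close>. Both laws then become products over the coordinates, with equal
  factors.\<close>

lemma noise_pair_eq_thinned_pair:
  assumes "0 < p" "p < r" "r < 1" "0 \<le> \<epsilon>" "\<epsilon> \<le> 1" "p / r = 1 - \<epsilon> * (1 - p)"
  shows "noise_pair_pmf n p \<epsilon> = thinned_pair_pmf n r (p / r)"
proof -
  let ?split = "\<lambda>h :: nat \<Rightarrow> bool \<times> bool. (\<lambda>i. fst (h i), \<lambda>i. snd (h i))"
  have "noise_pair_pmf n p \<epsilon> = map_pmf ?split (Pi_pmf {..<n} (False, False) (\<lambda>_.
      do { a \<leftarrow> bernoulli_pmf p; b \<leftarrow> bernoulli_pmf \<epsilon>; c \<leftarrow> bernoulli_pmf p;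
           return_pmf (a, if b then c else a) }))"
    by (subst Pi_pmf_bind3[where ?d1.0 = False and ?d2.0 = False and ?d3.0 = False])
      (simp_all add: noise_pair_pmf_def cube_pmf_def map_bind_pmf)
  also have "\<dots> = map_pmf ?split (Pi_pmf {..<n} (False, False) (\<lambda>_.
      do { a \<leftarrow> bernoulli_pmf r; b \<leftarrow> bernoulli_pmf (p / r); c \<leftarrow> bernoulli_pmf (p / r);
           return_pmf (a \<and> b, a \<and> c) }))"
    by (simp only: noise_coordinate_eq_thinned_coordinate[OF assms])
  also have "\<dots> = thinned_pair_pmf n r (p / r)"
    by (subst Pi_pmf_bind3[where ?d1.0 = False and ?d2.0 = False and ?d3.0 = False])
      (simp_all add: thinned_pair_pmf_def cube_pmf_def cw_prod_def map_bind_pmf)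
  finally show ?thesis .
qed

lemma finite_set_cube_pmf [simp]: "finite (set_pmf (cube_pmf n q))"
  unfolding cube_pmf_def by (subst set_Pi_pmf) (auto intro!: finite_PiE_dflt)

lemma integrable_cube_pmf [simp]: "integrable (measure_pmf (cube_pmf n q)) (g :: _ \<Rightarrow> real)"
  by (rule integrable_measure_pmf_finite) simp

lemma expectation_bind_finite:
  fixes g :: "'b \<Rightarrow> real"
  assumes "finite (set_pmf M)" "\<And>x. finite (set_pmf (N x))"
  shows "measure_pmf.expectation (bind_pmf M N) g =
         measure_pmf.expectation M (\<lambda>x. measure_pmf.expectation (N x) g)"
  using assms by (subst pmf_expectation_bind[where A = "set_pmf M"])
     (auto simp: integral_measure_pmf_real[where A="set_pmf M"] mult.commute)

text \<open>Given \<open>\<psi>\<close>, the two thinnings are independent with the same law, so the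
  square of the conditional expectation is the conditional expectation of \<open>f x * f y\<close>.
  Writing the mean through the first marginal of the pair leaves the pair law as the only object to
  be replaced later.\<close>

lemma variance_thinning:
  fixes f :: "(nat \<Rightarrow> bool) \<Rightarrow> real"
  shows "measure_pmf.variance (cube_pmf n r)
           (\<lambda>\<psi>. measure_pmf.expectation (cube_pmf n s) (\<lambda>\<xi>. f (cw_prod \<psi> \<xi>))) =
         measure_pmf.expectation (thinned_pair_pmf n r s) (\<lambda>(x, y). f x * f y) -
         (measure_pmf.expectation (map_pmf fst (thinned_pair_pmf n r s)) f)\<^sup>2"
  by (subst measure_pmf.variance_eq)
    (simp_all add: thinned_pair_pmf_def map_bind_pmf expectation_bind_finite power2_eq_square)

lemma map_fst_noise_pair_pmf: "map_pmf fst (noise_pair_pmf n p \<epsilon>) = cube_pmf n p"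
  by (simp add: noise_pair_pmf_def map_bind_pmf bind_return_pmf')

lemma variance_eq_noise_covariance:
  fixes f :: "(nat \<Rightarrow> bool) \<Rightarrow> real"
  assumes "0 < p" "p < r" "r < 1" "0 \<le> \<epsilon>" "\<epsilon> \<le> 1" "p / r = 1 - \<epsilon> * (1 - p)"
  shows "measure_pmf.variance (cube_pmf n r)
           (\<lambda>\<psi>. measure_pmf.expectation (cube_pmf n (p / r)) (\<lambda>\<xi>. f (cw_prod \<psi> \<xi>))) =
         measure_pmf.expectation (noise_pair_pmf n p \<epsilon>) (\<lambda>(x, y). f x * f y) -
         (measure_pmf.expectation (cube_pmf n p) f)\<^sup>2"
  unfolding variance_thinning noise_pair_eq_thinned_pair[OF assms, symmetric]
    map_fst_noise_pair_pmf ..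

theorem proposition2:
  fixes p :: real and f :: "nat \<Rightarrow> (nat \<Rightarrow> bool) \<Rightarrow> real"
  assumes "p \<in> {0<..<1}"
    and "\<And>n. n \<ge> 1 \<Longrightarrow> f n \<in> cube n \<rightarrow> {0..1}"
  shows "noise_sensitive p f \<longleftrightarrow>
    (\<forall>r\<in>{p<..<1}.
       (\<lambda>n. measure_pmf.variance (cube_pmf n r)
              (\<lambda>\<psi>. measure_pmf.expectation (cube_pmf n (p / r)) (\<lambda>\<xi>. f n (cw_prod \<psi> \<xi>)))) \<longlonglongrightarrow> 0)"
    (is "_ \<longleftrightarrow> (\<forall>r\<in>_. ?V r \<longlonglongrightarrow> 0)")
proof -
  have p: "0 < p" "p < 1" using assms(1) by auto
  let ?C = "\<lambda>\<epsilon> n. measure_pmf.expectation (noise_pair_pmf n p \<epsilon>) (\<lambda>(x, y). f n x * f n y) -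
      (measure_pmf.expectation (cube_pmf n p) (f n))\<^sup>2"
  have eq: "?V r = ?C \<epsilon>" if "p < r" "r < 1" "0 < \<epsilon>" "\<epsilon> < 1" "p / r = 1 - \<epsilon> * (1 - p)" for r \<epsilon>
    using that p by (intro ext variance_eq_noise_covariance) auto
  show ?thesis
    unfolding noise_sensitive_def
  proof (intro iffI ballI)
    fix r assume noise: "\<forall>\<epsilon>\<in>{0<..<1}. ?C \<epsilon> \<longlonglongrightarrow> 0" and "r \<in> {p<..<1}"
    then have r: "p < r" "r < 1" by auto
    \<comment> \<open>The solution of \<open>p / r = 1 - \<epsilon> * (1 - p)\<close> for
      \<open>\<epsilon>\<close>.\<close>
    define \<epsilon> where "\<epsilon> = (1 - p / r) / (1 - p)"
    have "p / r < 1" "p < p / r" using p r by (auto simp: field_simps)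
    then have "0 < \<epsilon>" "\<epsilon> < 1" using p by (auto simp: \<epsilon>_def field_simps)
    moreover have "p / r = 1 - \<epsilon> * (1 - p)" using p by (simp add: \<epsilon>_def)
    ultimately show "?V r \<longlonglongrightarrow> 0" using eq[OF r] noise by simp
  next
    fix \<epsilon> :: real assume thin: "\<forall>r\<in>{p<..<1}. ?V r \<longlonglongrightarrow> 0" and "\<epsilon> \<in> {0<..<1}"
    then have \<epsilon>: "0 < \<epsilon>" "\<epsilon> < 1" by auto
    \<comment> \<open>The prescribed value of \<open>p / r\<close>, so the witness for
      \<open>r\<close> is \<open>p / s\<close>.\<close>
    define s where "s = 1 - \<epsilon> * (1 - p)"
    \<comment> \<open>The two products equal \<open>1 - s\<close> and \<open>s - p\<close>.\<close>
    have "0 < \<epsilon> * (1 - p)" "0 < (1 - \<epsilon>) * (1 - p)" using p \<epsilon> by simp_all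
    then have s: "p < s" "s < 1" by (auto simp: s_def algebra_simps)
    have r: "p < p / s" "p / s < 1" using p s by (auto simp: field_simps)
    have "p / (p / s) = s" using p by simp
    then have "?V (p / s) = ?C \<epsilon>" using eq[OF r \<epsilon>] by (simp add: s_def)
    moreover have "?V (p / s) \<longlonglongrightarrow> 0" by (rule bspec[OF thin]) (use r in simp)
    ultimately show "?C \<epsilon> \<longlonglongrightarrow> 0" by (simp only:)
  qed
qed

end
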